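(* Let $A\in\mathbb{R}^{N\times N}$ be symmetric with nonnegative entries, let $\overline{A}\in\mathbb{R}^{N\times N}$ be a symmetric matrix whose off-diagonal entries coincide with those of $A$ and with spectral radius $\rho(\overline{A})<1$, let $\sigma>0$ and $\alpha>1$, and set $C=\sigma^2(I-\overline{A})^{-\alpha}$. Let $\{1,\dots,N\}=\mathcal S\cup\mathcal S'$ be a partition into disjoint nonempty sets. Then: (1) $\lambda_{\min}(C)=\sigma^2\big(1-\lambda_{\min}(\overline{A})\big)^{-\alpha}$; (2) $\|C_{\mathcal S\mathcal S'}\|\le \sigma^2\,\alpha\,(1-\rho(\overline{A}))^{-\alpha-1}\,\|A_{\mathcal S\mathcal S'}\|$.
   Context: $(I-\overline{A})^{-\alpha}$ is defined by spectral calculus ($I-\overline{A}$ is symmetric positive definite since $\rho(\overline{A})<1$). $\|\cdot\|$ is the spectral norm, $\lambda_{\min}$ the smallest eigenvalue, $\rho$ the spectral radius. For a matrix $M$, $M_{\mathcal S\mathcal S'}$ is the submatrix with rows in $\mathcal S$ and columns in $\mathcal S'$ (note $\overline{A}_{\mathcal S\mathcal S'}=A_{\mathcal S\mathcal S'}$). In the paper's model, $\overline{A}=I-\kappa^2 D-L$ with $L=D-A$, $D=\mathrm{diag}(A\mathbf 1)$, $\kappa>0$. *)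

theory Defs
  imports "HOL-Analysis.Analysis"
begin

text \<open>Real eigenvalues of a real square matrix (for symmetric matrices these are all eigenvalues).\<close>
definition eigvals :: "real^'n^'n \<Rightarrow> real set" where
  "eigvals M = {l. \<exists>v. v \<noteq> 0 \<and> M *v v = l *\<^sub>R v}"

definition lambda_min :: "real^'n^'n \<Rightarrow> real" where
  "lambda_min M = Min (eigvals M)"

definition spec_radius :: "real^'n^'n \<Rightarrow> real" where
  "spec_radius M = Max (abs ` eigvals M)"

text \<open>Spectral calculus for a symmetric matrix: f(M) is the matrix acting as f(l) on
  every eigenvector of M with eigenvalue l.\<close>
definition mat_fun :: "(real \<Rightarrow> real) \<Rightarrow> real^'n^'n \<Rightarrow> real^'n^'n" where
  "mat_fun f M = (THE B. \<forall>v l. M *v v = l *\<^sub>R v \<longrightarrow> B *v v = f l *\<^sub>R v)"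

text \<open>Spectral norm of the submatrix M_{S S'}: operator norm of the zero-padded block
  (zero padding is an isometry, so this equals the spectral norm of the submatrix).\<close>
definition sub_norm :: "real^'n^'n \<Rightarrow> 'n set \<Rightarrow> 'n set \<Rightarrow> real" where
  "sub_norm M S S' = onorm (\<lambda>x. (\<chi> i. if i \<in> S then (M *v (\<chi> j. if j \<in> S' then x $ j else 0)) $ i else 0))"

end

theory Submission
  imports Defs
begin

text \<open>
  A real symmetric matrix has an orthonormal eigenbasis (maximise the Rayleigh quotient on an
  invariant subspace and recurse on its orthogonal complement). In such a basis for \<open>Abar\<close> the
  covariance \<open>C\<close> acts diagonally with eigenvalues \<open>\<sigma>\<^sup>2 (1 - \<lambda>) powr -\<alpha>\<close>, which increase with
  \<open>\<lambda>\<close>; this gives the smallest eigenvalue.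

  For the block bound expand \<open>(I - Abar) powr -\<alpha> = (\<Sum>k. c\<^sub>k Abar\<^sup>k)\<close> with
  \<open>c\<^sub>k = pochhammer \<alpha> k / k! \<ge> 0\<close>. Let \<open>R\<close> flip the signs of the coordinates outside \<open>S\<close>. Then
  \<open>Abar - R Abar R\<close> consists of twice the two off-diagonal blocks, so it has norm at most
  \<open>2 \<parallel>A\<^bsub>SS'\<^esub>\<parallel>\<close>, and telescoping gives
  \<open>\<parallel>Abar\<^sup>k - (R Abar R)\<^sup>k\<parallel> \<le> 2 k \<rho>\<^bsup>k-1\<^esup> \<parallel>A\<^bsub>SS'\<^esub>\<parallel>\<close>.
  Since \<open>(R Abar R)\<^sup>k = R Abar\<^sup>k R\<close>, the \<open>SS'\<close> block of the left-hand side is twice that of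
  \<open>Abar\<^sup>k\<close>. Summing, \<open>(\<Sum>k. c\<^sub>k k \<rho>\<^bsup>k-1\<^esup>) = \<alpha> (1 - \<rho>) powr (-\<alpha> - 1)\<close>.
\<close>

section \<open>Orthonormal bases\<close>

definition orthonormal :: "'a::real_inner set \<Rightarrow> bool" where
  "orthonormal B \<longleftrightarrow> pairwise orthogonal B \<and> (\<forall>u\<in>B. norm u = 1)"

definition orthonormal_basis :: "'a::euclidean_space set \<Rightarrow> bool" where
  "orthonormal_basis B \<longleftrightarrow> finite B \<and> orthonormal B \<and> span B = UNIV"

lemma orthonormal_independent: "orthonormal B \<Longrightarrow> independent B"
  unfolding orthonormal_def by (intro pairwise_orthogonal_independent) auto

lemma orthonormal_basis_nonzero: "orthonormal_basis B \<Longrightarrow> u \<in> B \<Longrightarrow> u \<noteq> 0"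
  unfolding orthonormal_basis_def orthonormal_def by auto

lemma orthonormal_basis_sum_inner_scaleR:
  "orthonormal_basis B \<Longrightarrow> (\<Sum>u\<in>B. (x \<bullet> u) *\<^sub>R u) = x"
  unfolding orthonormal_basis_def orthonormal_def by (intro orthonormal_basis_expand) auto

lemma orthonormal_basis_inner:
  "orthonormal_basis B \<Longrightarrow> u \<in> B \<Longrightarrow> v \<in> B \<Longrightarrow> u \<bullet> v = (if u = v then 1 else 0)"
  unfolding orthonormal_basis_def orthonormal_def pairwise_def orthogonal_def
  by (auto simp: norm_eq_1)

lemma orthonormal_basis_inner_sum:
  assumes "orthonormal_basis B" "u \<in> B"
  shows "(\<Sum>v\<in>B. c v *\<^sub>R v) \<bullet> u = c u"
proof -
  have "(\<Sum>v\<in>B. c v *\<^sub>R v) \<bullet> u = (\<Sum>v\<in>B. if v = u then c u else 0)"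
    unfolding inner_sum_left
    by (intro sum.cong) (auto simp: orthonormal_basis_inner[OF assms(1) _ assms(2)])
  also have "\<dots> = c u" using assms by (simp add: orthonormal_basis_def)
  finally show ?thesis .
qed

lemma orthonormal_basis_norm_sum_squared:
  assumes "orthonormal_basis B"
  shows "(norm (\<Sum>u\<in>B. c u *\<^sub>R u))\<^sup>2 = (\<Sum>u\<in>B. (c u)\<^sup>2)"
proof -
  have "pairwise (\<lambda>u v. orthogonal (c u *\<^sub>R u) (c v *\<^sub>R v)) B"
    using assms unfolding orthonormal_basis_def orthonormal_def pairwise_def
    by (auto simp: orthogonal_clauses)
  then have "(norm (\<Sum>u\<in>B. c u *\<^sub>R u))\<^sup>2 = (\<Sum>u\<in>B. (norm (c u *\<^sub>R u))\<^sup>2)"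
    using assms by (intro norm_sum_Pythagorean) (auto simp: orthonormal_basis_def)
  also have "\<dots> = (\<Sum>u\<in>B. (c u)\<^sup>2)"
    using assms by (intro sum.cong) (auto simp: orthonormal_basis_def orthonormal_def)
  finally show ?thesis .
qed

lemma orthonormal_basis_nonempty:
  fixes B :: "'a::euclidean_space set"
  assumes "orthonormal_basis B"
  shows "B \<noteq> {}"
proof
  assume "B = {}"
  then have "(UNIV :: 'a set) = {0}" using assms by (simp add: orthonormal_basis_def)
  moreover obtain b :: 'a where "b \<in> Basis" using nonempty_Basis by blast
  ultimately show False using Basis_zero by auto
qed

lemma linear_eigenbasis_expand:
  assumes f: "linear f" and B: "orthonormal_basis B" and eig: "\<And>u. u \<in> B \<Longrightarrow> f u = \<mu> u *\<^sub>R u"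
  shows "f x = (\<Sum>u\<in>B. (\<mu> u * (x \<bullet> u)) *\<^sub>R u)"
proof -
  have "f x = f (\<Sum>u\<in>B. (x \<bullet> u) *\<^sub>R u)" using orthonormal_basis_sum_inner_scaleR[OF B] by simp
  also have "\<dots> = (\<Sum>u\<in>B. (x \<bullet> u) *\<^sub>R f u)" by (simp add: linear_sum[OF f] linear_scale[OF f])
  also have "\<dots> = (\<Sum>u\<in>B. (\<mu> u * (x \<bullet> u)) *\<^sub>R u)" by (intro sum.cong) (simp_all add: eig)
  finally show ?thesis .
qed

lemma norm_le_eigenbasis:
  assumes f: "linear f" and B: "orthonormal_basis B" and eig: "\<And>u. u \<in> B \<Longrightarrow> f u = \<mu> u *\<^sub>R u"
    and r: "\<And>u. u \<in> B \<Longrightarrow> \<bar>\<mu> u\<bar> \<le> r"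
  shows "norm (f x) \<le> r * norm x"
proof -
  have "0 \<le> r" using r orthonormal_basis_nonempty[OF B] by (meson abs_ge_zero all_not_in_conv order_trans)
  have "(norm (f x))\<^sup>2 = (\<Sum>u\<in>B. (\<mu> u * (x \<bullet> u))\<^sup>2)"
    using linear_eigenbasis_expand[OF f B eig, of x] orthonormal_basis_norm_sum_squared[OF B] by simp
  also have "\<dots> \<le> (\<Sum>u\<in>B. r\<^sup>2 * (x \<bullet> u)\<^sup>2)"
  proof (intro sum_mono)
    fix u assume "u \<in> B"
    then have "(\<mu> u)\<^sup>2 \<le> r\<^sup>2" using r by (simp add: abs_le_square_iff[symmetric] \<open>0 \<le> r\<close>)
    then show "(\<mu> u * (x \<bullet> u))\<^sup>2 \<le> r\<^sup>2 * (x \<bullet> u)\<^sup>2" by (simp add: power_mult_distrib mult_right_mono)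
  qed
  also have "\<dots> = r\<^sup>2 * (norm x)\<^sup>2"
    using orthonormal_basis_norm_sum_squared[OF B, of "\<lambda>u. x \<bullet> u"]
    by (simp add: sum_distrib_left orthonormal_basis_sum_inner_scaleR[OF B])
  finally have "(norm (f x))\<^sup>2 \<le> (r * norm x)\<^sup>2" by (simp add: power_mult_distrib)
  then show ?thesis by (rule power2_le_imp_le) (simp add: \<open>0 \<le> r\<close>)
qed

section \<open>The spectral theorem for real symmetric matrices\<close>

lemma symmetric_matrix_inner:
  fixes M :: "real^'n^'n"
  assumes "transpose M = M"
  shows "(M *v x) \<bullet> y = x \<bullet> (M *v y)"
  by (metis assms dot_lmul_matrix vector_transpose_matrix)

lemma linear_coeff_eq_0_if_quadratic_nonpos:
  fixes a b :: real
  assumes "\<And>t. t * a + t\<^sup>2 * b \<le> 0"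
  shows "a = 0"
proof (rule ccontr)
  assume "a \<noteq> 0"
  define s where "s = 1 / (\<bar>b\<bar> + 1)"
  have "s > 0" "s * \<bar>b\<bar> < 1" unfolding s_def by (auto simp: field_simps)
  moreover have "- (s * \<bar>b\<bar>) \<le> s * b"
    using mult_left_mono[of "- \<bar>b\<bar>" b s] \<open>s > 0\<close> by simp
  ultimately have "1 + s * b > 0" by linarith
  have "(s * a) * a + (s * a)\<^sup>2 * b = a\<^sup>2 * (s * (1 + s * b))"
    by (simp add: power2_eq_square algebra_simps)
  also have "\<dots> > 0" using \<open>a \<noteq> 0\<close> \<open>s > 0\<close> \<open>1 + s * b > 0\<close> by simp
  finally show False using assms[of "s * a"] by simp
qed

lemma symmetric_max_quadratic_form_eigenvector:
  fixes M :: "real^'n^'n"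
  assumes sym: "transpose M = M" and W: "subspace W" and inv: "\<And>w. w \<in> W \<Longrightarrow> M *v w \<in> W"
    and x: "x \<in> W" "x \<bullet> x = 1"
    and max: "\<And>z. z \<in> W \<Longrightarrow> z \<bullet> (M *v z) \<le> (x \<bullet> (M *v x)) * (z \<bullet> z)"
  shows "M *v x = (x \<bullet> (M *v x)) *\<^sub>R x"
proof -
  define l where "l = x \<bullet> (M *v x)"
  \<comment> \<open>first variation of the Rayleigh quotient at \<open>x\<close> in the direction \<open>y\<close>\<close>
  have stationary: "2 * (y \<bullet> (M *v x) - l * (x \<bullet> y)) = 0" if y: "y \<in> W" for y
  proof (rule linear_coeff_eq_0_if_quadratic_nonpos[where b = "y \<bullet> (M *v y) - l * (y \<bullet> y)"])
    fix t
    have "x + t *\<^sub>R y \<in> W" using x y W by (simp add: subspace_add subspace_scale)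
    then have "(x + t *\<^sub>R y) \<bullet> (M *v (x + t *\<^sub>R y)) \<le> l * ((x + t *\<^sub>R y) \<bullet> (x + t *\<^sub>R y))"
      using max l_def by blast
    moreover have "x \<bullet> (M *v y) = y \<bullet> (M *v x)"
      using symmetric_matrix_inner[OF sym, of y x] by (simp add: inner_commute)
    ultimately show "t * (2 * (y \<bullet> (M *v x) - l * (x \<bullet> y))) + t\<^sup>2 * (y \<bullet> (M *v y) - l * (y \<bullet> y)) \<le> 0"
      by (simp add: l_def x(2) inner_commute[of y x] power2_eq_square algebra_simps)
  qed
  define y where "y = M *v x - l *\<^sub>R x"
  have "y \<in> W" unfolding y_def using inv x W by (simp add: subspace_diff subspace_scale)
  from stationary[OF this] have "y \<bullet> y = 0"
    unfolding y_def by (simp add: l_def inner_commute x(2) algebra_simps)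
  then show ?thesis unfolding y_def l_def by simp
qed

lemma symmetric_invariant_subspace_eigenvector:
  fixes M :: "real^'n^'n"
  assumes sym: "transpose M = M" and W: "subspace W" and inv: "\<And>w. w \<in> W \<Longrightarrow> M *v w \<in> W"
    and "w \<in> W" "w \<noteq> 0"
  obtains x l where "x \<in> W" "norm x = 1" "M *v x = l *\<^sub>R x"
proof -
  define K where "K = W \<inter> sphere 0 1"
  have "compact K" unfolding K_def by (intro closed_Int_compact closed_subspace W compact_sphere)
  moreover have "w /\<^sub>R norm w \<in> K" unfolding K_def using assms(4,5) W by (auto simp: subspace_scale)
  then have "K \<noteq> {}" by blast
  moreover have "continuous_on K (\<lambda>x. x \<bullet> (M *v x))"
    by (intro continuous_intros linear_continuous_on matrix_vector_mul_bounded_linear)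
  ultimately obtain x where x: "x \<in> K" and xmax: "\<And>y. y \<in> K \<Longrightarrow> y \<bullet> (M *v y) \<le> x \<bullet> (M *v x)"
    by (metis continuous_attains_sup)
  have "x \<in> W" "norm x = 1" using x by (auto simp: K_def)
  then have xx: "x \<bullet> x = 1" by (simp add: power2_norm_eq_inner[symmetric])
  have "z \<bullet> (M *v z) \<le> (x \<bullet> (M *v x)) * (z \<bullet> z)" if "z \<in> W" for z
  proof (cases "z = 0")
    case False
    define z' where "z' = z /\<^sub>R norm z"
    have "z' \<in> K" unfolding K_def z'_def using \<open>z \<in> W\<close> False W by (auto simp: subspace_scale)
    then have "z' \<bullet> (M *v z') \<le> x \<bullet> (M *v x)" by (rule xmax)
    moreover have "z' \<bullet> (M *v z') = (z \<bullet> (M *v z)) / (norm z)\<^sup>2"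
      unfolding z'_def by (simp add: matrix_vector_mult_scaleR power2_eq_square divide_simps)
    moreover have "z \<bullet> z = (norm z)\<^sup>2" by (simp add: power2_norm_eq_inner)
    moreover have "(norm z)\<^sup>2 > 0" using False by simp
    ultimately show ?thesis by (simp add: divide_le_eq mult.commute)
  qed simp
  from symmetric_max_quadratic_form_eigenvector[OF sym W inv \<open>x \<in> W\<close> xx this]
  show thesis using that \<open>x \<in> W\<close> \<open>norm x = 1\<close> by blast
qed

lemma symmetric_orthonormal_eigenvectors_extend:
  fixes M :: "real^'n^'n"
  assumes sym: "transpose M = M" and B: "finite B" "orthonormal B"
    and eig: "\<forall>u\<in>B. \<exists>l. M *v u = l *\<^sub>R u" and card: "card B < CARD('n)"
  obtains x where "x \<notin> B" "orthonormal (insert x B)" "\<exists>l. M *v x = l *\<^sub>R x"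
proof -
  define W where "W = {y. \<forall>u\<in>B. orthogonal u y}"
  have W: "subspace W" unfolding W_def by (rule subspace_orthogonal_to_vectors)
  have "dim B < DIM(real^'n)"
    using card orthonormal_independent[OF B(2)] by (simp add: dim_eq_card_independent)
  then obtain w where "w \<noteq> 0" "\<And>y. y \<in> span B \<Longrightarrow> orthogonal w y"
    using orthogonal_to_subspace_exists by blast
  then have "w \<in> W" unfolding W_def by (auto intro: span_base simp: orthogonal_commute)
  have inv: "M *v y \<in> W" if "y \<in> W" for y
  proof -
    have "orthogonal u (M *v y)" if "u \<in> B" for u
    proof -
      obtain l where "M *v u = l *\<^sub>R u" using eig \<open>u \<in> B\<close> by blast
      then have "u \<bullet> (M *v y) = l * (u \<bullet> y)" using symmetric_matrix_inner[OF sym, of u y] by simp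
      then show ?thesis using \<open>y \<in> W\<close> \<open>u \<in> B\<close> by (simp add: W_def orthogonal_def)
    qed
    then show ?thesis by (simp add: W_def)
  qed
  obtain x l where x: "x \<in> W" "norm x = 1" "M *v x = l *\<^sub>R x"
    using symmetric_invariant_subspace_eigenvector[OF sym W inv \<open>w \<in> W\<close> \<open>w \<noteq> 0\<close>] .
  have "x \<notin> B" using x by (auto simp: W_def orthogonal_self)
  moreover have "orthonormal (insert x B)"
    using B(2) x unfolding orthonormal_def W_def by (auto simp: pairwise_insert orthogonal_commute)
  ultimately show thesis using that x by blast
qed

theorem symmetric_matrix_orthonormal_eigenbasis:
  fixes M :: "real^'n^'n"
  assumes sym: "transpose M = M"
  obtains B ev where "orthonormal_basis B" "\<And>u. u \<in> B \<Longrightarrow> M *v u = ev u *\<^sub>R u"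
proof -
  have "\<exists>B. finite B \<and> orthonormal B \<and> (\<forall>u\<in>B. \<exists>l. M *v u = l *\<^sub>R u) \<and> card B = k"
    if "k \<le> CARD('n)" for k
    using that
  proof (induction k)
    case 0
    show ?case by (intro exI[of _ "{}"]) (simp add: orthonormal_def)
  next
    case (Suc k)
    then obtain B where B: "finite B" "orthonormal B" "\<forall>u\<in>B. \<exists>l. M *v u = l *\<^sub>R u" "card B = k"
      by auto
    with Suc.prems obtain x where "x \<notin> B" "orthonormal (insert x B)" "\<exists>l. M *v x = l *\<^sub>R x"
      using symmetric_orthonormal_eigenvectors_extend[OF sym B(1-3)] by auto
    with B show ?case by (intro exI[of _ "insert x B"]) auto
  qed
  then obtain B where B: "finite B" "orthonormal B" "\<forall>u\<in>B. \<exists>l. M *v u = l *\<^sub>R u" "card B = CARD('n)"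
    by blast
  have "dim B = DIM(real^'n)"
    using B(4) orthonormal_independent[OF B(2)] by (simp add: dim_eq_card_independent)
  then have "span B = UNIV" using dim_eq_full by blast
  moreover obtain ev where "\<And>u. u \<in> B \<Longrightarrow> M *v u = ev u *\<^sub>R u" using B(3) by metis
  ultimately show thesis using that B unfolding orthonormal_basis_def by blast
qed

section \<open>Eigenvalues and spectral calculus\<close>

lemma matrix_eigenbasis_expand:
  fixes K :: "real^'n^'n"
  assumes "orthonormal_basis B" "\<And>u. u \<in> B \<Longrightarrow> K *v u = \<mu> u *\<^sub>R u"
  shows "K *v x = (\<Sum>u\<in>B. (\<mu> u * (x \<bullet> u)) *\<^sub>R u)"
  using linear_eigenbasis_expand[OF matrix_vector_mul_linear assms] .

lemma eigvals_eigenbasis: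
  fixes K :: "real^'n^'n"
  assumes B: "orthonormal_basis B" and eig: "\<And>u. u \<in> B \<Longrightarrow> K *v u = \<mu> u *\<^sub>R u"
  shows "eigvals K = \<mu> ` B"
proof
  show "\<mu> ` B \<subseteq> eigvals K"
  proof
    fix l assume "l \<in> \<mu> ` B"
    then obtain u where "u \<in> B" "l = \<mu> u" by blast
    moreover have "u \<noteq> 0" using B \<open>u \<in> B\<close> by (rule orthonormal_basis_nonzero)
    ultimately show "l \<in> eigvals K" using eig unfolding eigvals_def by blast
  qed
next
  show "eigvals K \<subseteq> \<mu> ` B"
  proof
    fix l assume "l \<in> eigvals K"
    then obtain v where v: "v \<noteq> 0" "K *v v = l *\<^sub>R v" unfolding eigvals_def by blast
    have "\<exists>u\<in>B. v \<bullet> u \<noteq> 0"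
    proof (rule ccontr)
      assume "\<not> (\<exists>u\<in>B. v \<bullet> u \<noteq> 0)"
      then have "(\<Sum>u\<in>B. (v \<bullet> u) *\<^sub>R u) = 0" by simp
      then show False using orthonormal_basis_sum_inner_scaleR[OF B, of v] v(1) by simp
    qed
    then obtain u where u: "u \<in> B" "v \<bullet> u \<noteq> 0" by blast
    have "l * (v \<bullet> u) = (K *v v) \<bullet> u" using v(2) by simp
    also have "\<dots> = \<mu> u * (v \<bullet> u)"
      using matrix_eigenbasis_expand[OF B eig, of v] orthonormal_basis_inner_sum[OF B u(1)] by simp
    finally show "l \<in> \<mu> ` B" using u by auto
  qed
qed

lemma eigenvector_in_eigvals: "v \<noteq> 0 \<Longrightarrow> M *v v = l *\<^sub>R v \<Longrightarrow> l \<in> eigvals M"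
  unfolding eigvals_def by blast

lemma finite_eigvals_symmetric:
  fixes M :: "real^'n^'n"
  assumes "transpose M = M"
  shows "finite (eigvals M)"
proof -
  obtain B ev where "orthonormal_basis B" "\<And>u. u \<in> B \<Longrightarrow> M *v u = ev u *\<^sub>R u"
    using symmetric_matrix_orthonormal_eigenbasis[OF assms] by blast
  then have "eigvals M = ev ` B" by (rule eigvals_eigenbasis)
  then show ?thesis using \<open>orthonormal_basis B\<close> by (simp add: orthonormal_basis_def)
qed

lemma eigvals_nonempty_symmetric:
  fixes M :: "real^'n^'n"
  assumes "transpose M = M"
  shows "eigvals M \<noteq> {}"
proof -
  obtain B ev where "orthonormal_basis B" "\<And>u. u \<in> B \<Longrightarrow> M *v u = ev u *\<^sub>R u"
    using symmetric_matrix_orthonormal_eigenbasis[OF assms] by blast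
  then have "eigvals M = ev ` B" by (rule eigvals_eigenbasis)
  then show ?thesis using orthonormal_basis_nonempty[OF \<open>orthonormal_basis B\<close>] by simp
qed

lemma abs_le_spec_radius:
  fixes M :: "real^'n^'n"
  assumes "transpose M = M" "l \<in> eigvals M"
  shows "\<bar>l\<bar> \<le> spec_radius M"
  unfolding spec_radius_def using finite_eigvals_symmetric[OF assms(1)] assms(2) by simp

lemma spec_radius_nonneg:
  fixes M :: "real^'n^'n"
  assumes "transpose M = M"
  shows "0 \<le> spec_radius M"
  using eigvals_nonempty_symmetric[OF assms] abs_le_spec_radius[OF assms]
  by (meson abs_ge_zero all_not_in_conv order_trans)

lemma norm_matrix_vector_le_spec_radius:
  fixes M :: "real^'n^'n"
  assumes sym: "transpose M = M"
  shows "norm (M *v x) \<le> spec_radius M * norm x"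
proof -
  obtain B ev where B: "orthonormal_basis B" and eig: "\<And>u. u \<in> B \<Longrightarrow> M *v u = ev u *\<^sub>R u"
    using symmetric_matrix_orthonormal_eigenbasis[OF sym] by blast
  have "\<bar>ev u\<bar> \<le> spec_radius M" if "u \<in> B" for u
    using abs_le_spec_radius[OF sym eigenvector_in_eigvals[OF orthonormal_basis_nonzero[OF B that] eig[OF that]]] .
  from norm_le_eigenbasis[OF matrix_vector_mul_linear B eig this] show ?thesis .
qed

lemma symmetric_eigenvectors_orthogonal:
  fixes M :: "real^'n^'n"
  assumes "transpose M = M" "M *v v = l *\<^sub>R v" "M *v u = e *\<^sub>R u" "e \<noteq> l"
  shows "v \<bullet> u = 0"
proof -
  have "l * (v \<bullet> u) = e * (v \<bullet> u)"
    using symmetric_matrix_inner[OF assms(1), of v u] assms(2,3) by simp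
  then show ?thesis using assms(4) by simp
qed

lemma mat_fun_eigenvector:
  fixes M :: "real^'n^'n"
  assumes sym: "transpose M = M" and "M *v v = l *\<^sub>R v"
  shows "mat_fun f M *v v = f l *\<^sub>R v"
proof -
  obtain B ev where B: "orthonormal_basis B" and eig: "\<And>u. u \<in> B \<Longrightarrow> M *v u = ev u *\<^sub>R u"
    using symmetric_matrix_orthonormal_eigenbasis[OF sym] by blast
  let ?P = "\<lambda>G. \<forall>v l. M *v v = l *\<^sub>R v \<longrightarrow> G *v v = f l *\<^sub>R v"
  define F where "F = matrix (\<lambda>x. \<Sum>u\<in>B. (f (ev u) * (x \<bullet> u)) *\<^sub>R u)"
  have "linear (\<lambda>x. \<Sum>u\<in>B. (f (ev u) * (x \<bullet> u)) *\<^sub>R u)"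
    by (auto intro!: linearI simp: algebra_simps sum.distrib scaleR_sum_right)
  then have F: "F *v x = (\<Sum>u\<in>B. (f (ev u) * (x \<bullet> u)) *\<^sub>R u)" for x
    unfolding F_def by (simp add: matrix_works linear_matrix_vector_mul_eq)
  have "?P F"
  proof (intro allI impI)
    fix v l assume v: "M *v v = l *\<^sub>R v"
    have "F *v v = (\<Sum>u\<in>B. (f l * (v \<bullet> u)) *\<^sub>R u)"
      unfolding F using symmetric_eigenvectors_orthogonal[OF sym v eig] by (intro sum.cong) auto
    also have "\<dots> = f l *\<^sub>R (\<Sum>u\<in>B. (v \<bullet> u) *\<^sub>R u)" by (simp add: scaleR_sum_right)
    also have "\<dots> = f l *\<^sub>R v" by (simp add: orthonormal_basis_sum_inner_scaleR[OF B])
    finally show "F *v v = f l *\<^sub>R v" .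
  qed
  moreover have "G = F" if G: "?P G" for G
  proof -
    have "G *v u = f (ev u) *\<^sub>R u" if "u \<in> B" for u
      using G eig[OF that] by blast
    then have "G *v x = F *v x" for x
      unfolding F by (rule matrix_eigenbasis_expand[OF B])
    then show ?thesis by (simp add: matrix_eq)
  qed
  ultimately have "?P (mat_fun f M)" unfolding mat_fun_def by (rule theI)
  then show ?thesis using assms(2) by blast
qed

lemma mat_fun_one_minus_eigenvector:
  fixes M :: "real^'n^'n"
  assumes sym: "transpose M = M" and "M *v v = l *\<^sub>R v"
  shows "mat_fun f (mat 1 - M) *v v = f (1 - l) *\<^sub>R v"
proof (rule mat_fun_eigenvector)
  show "transpose (mat 1 - M) = mat 1 - M"
    using sym by (simp add: vec_eq_iff transpose_def mat_def)
  show "(mat 1 - M) *v v = (1 - l) *\<^sub>R v"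
    using assms(2) by (simp add: algebra_simps)
qed

lemma Min_image_mono_on:
  assumes "mono_on A f" "finite A" "A \<noteq> {}"
  shows "Min (f ` A) = f (Min A)"
proof (rule Min_eqI)
  fix y assume "y \<in> f ` A"
  then obtain x where "x \<in> A" "y = f x" by blast
  moreover have "Min A \<le> x" using assms(2) \<open>x \<in> A\<close> by simp
  ultimately show "f (Min A) \<le> y"
    using mono_onD[OF assms(1) Min_in[OF assms(2,3)]] by simp
qed (use assms in auto)

lemma lambda_min_scaleR_mat_fun_powr:
  fixes M :: "real^'n^'n"
  assumes sym: "transpose M = M" and \<rho>: "spec_radius M < 1" and "0 < c" "0 \<le> a"
  shows "lambda_min (c *\<^sub>R mat_fun (\<lambda>x. x powr -a) (mat 1 - M)) = c * (1 - lambda_min M) powr -a"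
proof -
  obtain B ev where B: "orthonormal_basis B" and eig: "\<And>u. u \<in> B \<Longrightarrow> M *v u = ev u *\<^sub>R u"
    using symmetric_matrix_orthonormal_eigenbasis[OF sym] by blast
  define h where "h l = c * (1 - l) powr -a" for l
  have "(c *\<^sub>R mat_fun (\<lambda>x. x powr -a) (mat 1 - M)) *v u = h (ev u) *\<^sub>R u" if "u \<in> B" for u
    using mat_fun_one_minus_eigenvector[OF sym eig[OF that]]
    by (simp add: h_def scaleR_matrix_vector_assoc[symmetric])
  then have "eigvals (c *\<^sub>R mat_fun (\<lambda>x. x powr -a) (mat 1 - M)) = (\<lambda>u. h (ev u)) ` B"
    by (rule eigvals_eigenbasis[OF B])
  also have "\<dots> = h ` eigvals M" by (simp add: eigvals_eigenbasis[OF B eig] image_image)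
  finally have "eigvals (c *\<^sub>R mat_fun (\<lambda>x. x powr -a) (mat 1 - M)) = h ` eigvals M" .
  moreover have "mono_on (eigvals M) h"
  proof (rule mono_onI)
    fix l l' assume "l \<in> eigvals M" "l' \<in> eigvals M" "l \<le> l'"
    moreover have "\<bar>l'\<bar> < 1" using abs_le_spec_radius[OF sym \<open>l' \<in> eigvals M\<close>] \<rho> by linarith
    ultimately show "h l \<le> h l'"
      unfolding h_def using \<open>0 < c\<close> \<open>0 \<le> a\<close> by (intro mult_left_mono powr_mono2') auto
  qed
  then have "Min (h ` eigvals M) = h (Min (eigvals M))"
    using finite_eigvals_symmetric[OF sym] eigvals_nonempty_symmetric[OF sym] by (rule Min_image_mono_on)
  ultimately show ?thesis unfolding lambda_min_def h_def by simp
qed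

section \<open>The binomial series of (1 - t) powr -a\<close>

definition neg_binomial_coeff :: "real \<Rightarrow> nat \<Rightarrow> real" where
  "neg_binomial_coeff a k = pochhammer a k / fact k"

lemma neg_binomial_coeff_nonneg:
  assumes "0 \<le> a"
  shows "0 \<le> neg_binomial_coeff a k"
proof -
  have "0 \<le> pochhammer a k" using assms by (induction k) (simp_all add: pochhammer_Suc)
  then show ?thesis by (simp add: neg_binomial_coeff_def)
qed

lemma neg_binomial_coeff_Suc:
  "neg_binomial_coeff a (Suc k) * real (Suc k) = a * neg_binomial_coeff (a + 1) k"
  unfolding neg_binomial_coeff_def by (simp add: pochhammer_rec field_simps del: of_nat_Suc)

lemma neg_binomial_series:
  fixes t :: real
  assumes "\<bar>t\<bar> < 1"
  shows "(\<lambda>k. neg_binomial_coeff a k * t ^ k) sums (1 - t) powr -a"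
proof -
  have "((-a) gchoose k) * (-t) ^ k = neg_binomial_coeff a k * t ^ k" for k
  proof -
    have "((-a) gchoose k) * (-t) ^ k = ((-1) ^ k * (-1) ^ k) * (pochhammer a k / fact k * t ^ k)"
      by (simp add: gbinomial_pochhammer power_minus[of t] algebra_simps)
    also have "(-1 :: real) ^ k * (-1) ^ k = 1" by (simp add: power_mult_distrib[symmetric])
    finally show ?thesis by (simp add: neg_binomial_coeff_def)
  qed
  with gen_binomial_real[of "-t" "-a"] assms show ?thesis by simp
qed

lemma neg_binomial_series_deriv:
  fixes r :: real
  assumes "\<bar>r\<bar> < 1"
  shows "(\<lambda>k. neg_binomial_coeff a k * (real k * r ^ (k - 1))) sums (a * (1 - r) powr (-a - 1))"
proof -
  have e: "-(a + 1) = -a - 1" by simp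
  have shifted: "a * (neg_binomial_coeff (a + 1) k * r ^ k)
    = neg_binomial_coeff a (Suc k) * (real (Suc k) * r ^ (Suc k - 1))" for k
  proof -
    have "neg_binomial_coeff a (Suc k) * (real (Suc k) * r ^ (Suc k - 1))
      = (neg_binomial_coeff a (Suc k) * real (Suc k)) * r ^ k"
      by (simp only: diff_Suc_1 mult.assoc)
    also have "\<dots> = a * (neg_binomial_coeff (a + 1) k * r ^ k)"
      by (simp only: neg_binomial_coeff_Suc mult.assoc)
    finally show ?thesis by (rule sym)
  qed
  have "(\<lambda>k. neg_binomial_coeff a (Suc k) * (real (Suc k) * r ^ (Suc k - 1))) sums (a * (1 - r) powr (-a - 1))"
    using sums_mult[OF neg_binomial_series[OF assms, of "a + 1"], of a] unfolding e shifted .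
  from sums_Suc[OF this] show ?thesis by simp
qed

section \<open>Iterates of linear maps\<close>

lemma linear_funpow:
  fixes f :: "'a::real_vector \<Rightarrow> 'a"
  assumes "linear f"
  shows "linear (f ^^ k)"
proof (induction k)
  case 0
  show ?case by (simp add: linear_iff)
next
  case (Suc k)
  show ?case using linear_compose[OF Suc assms] by (simp add: comp_def)
qed

lemma funpow_eigenvector:
  fixes f :: "'a::real_vector \<Rightarrow> 'a"
  assumes "linear f" "f v = l *\<^sub>R v"
  shows "(f ^^ k) v = l ^ k *\<^sub>R v"
  by (induction k) (simp_all add: assms linear_scale)

lemma norm_funpow_le:
  fixes g :: "'a::real_normed_vector \<Rightarrow> 'a"
  assumes "\<And>x. norm (g x) \<le> r * norm x" "0 \<le> r"
  shows "norm ((g ^^ k) x) \<le> r ^ k * norm x"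
proof (induction k)
  case (Suc k)
  have "norm ((g ^^ Suc k) x) \<le> r * norm ((g ^^ k) x)" using assms(1) by simp
  also have "\<dots> \<le> r * (r ^ k * norm x)" using Suc assms(2) by (rule mult_left_mono)
  finally show ?case by (simp add: mult.assoc)
qed simp

lemma norm_funpow_diff_le:
  fixes f g :: "'a::real_normed_vector \<Rightarrow> 'a"
  assumes f: "linear f" "\<And>x. norm (f x) \<le> r * norm x" and g: "\<And>x. norm (g x) \<le> r * norm x"
    and "0 \<le> r" and fg: "\<And>x. norm (f x - g x) \<le> e * norm x" and "0 \<le> e"
  shows "norm ((f ^^ k) x - (g ^^ k) x) \<le> real k * r ^ (k - 1) * e * norm x"
proof (induction k)
  case (Suc k)
  define a where "a = (f ^^ k) x"
  define b where "b = (g ^^ k) x"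
  have "(f ^^ Suc k) x - (g ^^ Suc k) x = f (a - b) + (f b - g b)"
    by (simp add: a_def b_def linear_diff[OF f(1)])
  then have "norm ((f ^^ Suc k) x - (g ^^ Suc k) x) \<le> norm (f (a - b)) + norm (f b - g b)"
    by (simp add: norm_triangle_ineq)
  also have "\<dots> \<le> r * (real k * r ^ (k - 1) * e * norm x) + e * (r ^ k * norm x)"
  proof (rule add_mono)
    show "norm (f (a - b)) \<le> r * (real k * r ^ (k - 1) * e * norm x)"
      using f(2)[of "a - b"] mult_left_mono[OF Suc[folded a_def b_def] \<open>0 \<le> r\<close>] by linarith
    show "norm (f b - g b) \<le> e * (r ^ k * norm x)"
      using fg[of b] mult_left_mono[OF norm_funpow_le[OF g \<open>0 \<le> r\<close>, of k x] \<open>0 \<le> e\<close>]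
      unfolding b_def by linarith
  qed
  also have "\<dots> = real (Suc k) * r ^ (Suc k - 1) * e * norm x"
    by (cases k) (simp_all add: algebra_simps)
  finally show ?case .
qed simp

section \<open>Off-diagonal blocks\<close>

definition coord_proj :: "'n set \<Rightarrow> real^'n \<Rightarrow> real^'n" where
  "coord_proj S x = (\<chi> i. if i \<in> S then x $ i else 0)"

lemma coord_proj_component [simp]: "coord_proj S x $ i = (if i \<in> S then x $ i else 0)"
  by (simp add: coord_proj_def)

lemma linear_coord_proj: "linear (coord_proj S)"
  by (auto intro!: linearI simp: vec_eq_iff)

lemma bounded_linear_coord_proj: "bounded_linear (coord_proj S)"
  using linear_coord_proj by (simp add: linear_conv_bounded_linear)

lemma norm_coord_proj_le: "norm (coord_proj S x) \<le> norm x"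
  unfolding norm_vec_def by (rule L2_set_mono) auto

lemma inner_coord_proj: "coord_proj S x \<bullet> y = x \<bullet> coord_proj S y"
  unfolding inner_vec_def by (intro sum.cong) auto

lemma coord_proj_coord_proj [simp]: "coord_proj S (coord_proj S x) = coord_proj S x"
  by (simp add: vec_eq_iff)

lemma coord_proj_add_Compl [simp]: "coord_proj S x + coord_proj (-S) x = x"
  by (simp add: vec_eq_iff)

lemma norm_coord_proj_add_Compl_squared:
  "(norm (coord_proj S x + coord_proj (-S) y))\<^sup>2 = (norm (coord_proj S x))\<^sup>2 + (norm (coord_proj (-S) y))\<^sup>2"
proof (rule norm_add_Pythagorean)
  show "orthogonal (coord_proj S x) (coord_proj (-S) y)"
    unfolding orthogonal_def inner_vec_def by (intro sum.neutral) auto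
qed

lemma bounded_linear_block: "bounded_linear (\<lambda>x. coord_proj S (M *v coord_proj T x))"
  by (rule bounded_linear_compose[OF bounded_linear_coord_proj
        bounded_linear_compose[OF matrix_vector_mul_bounded_linear bounded_linear_coord_proj]])

lemma sub_norm_eq_onorm: "sub_norm M S T = onorm (\<lambda>x. coord_proj S (M *v coord_proj T x))"
  unfolding sub_norm_def coord_proj_def ..

lemma norm_block_le_sub_norm: "norm (coord_proj S (M *v coord_proj T x)) \<le> sub_norm M S T * norm x"
  unfolding sub_norm_eq_onorm by (rule onorm[OF bounded_linear_block])

lemma sub_norm_nonneg: "0 \<le> sub_norm M S T"
  unfolding sub_norm_eq_onorm by (rule onorm_pos_le[OF bounded_linear_block])

lemma sub_norm_scaleR: "sub_norm (c *\<^sub>R M) S T = \<bar>c\<bar> * sub_norm M S T"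
  unfolding sub_norm_eq_onorm
  by (simp add: scaleR_matrix_vector_assoc[symmetric] linear_scale[OF linear_coord_proj]
      onorm_scaleR[OF bounded_linear_block])

lemma sub_norm_cong:
  assumes "\<And>i j. i \<in> S \<Longrightarrow> j \<in> T \<Longrightarrow> M $ i $ j = N $ i $ j"
  shows "sub_norm M S T = sub_norm N S T"
proof -
  have "coord_proj S (M *v coord_proj T x) = coord_proj S (N *v coord_proj T x)" for x
  proof -
    have "(M *v coord_proj T x) $ i = (N *v coord_proj T x) $ i" if "i \<in> S" for i
      unfolding matrix_vector_mult_def using assms that by (auto intro!: sum.cong)
    then show ?thesis by (simp add: vec_eq_iff)
  qed
  then show ?thesis unfolding sub_norm_eq_onorm by simp
qed

lemma sub_norm_transpose_le: "sub_norm (transpose M) T S \<le> sub_norm M S T"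
  unfolding sub_norm_eq_onorm[of "transpose M"]
proof (rule onorm_le)
  fix z
  define w where "w = transpose M *v coord_proj S z"
  define v where "v = coord_proj T w"
  have "(norm v)\<^sup>2 = v \<bullet> v" by (rule power2_norm_eq_inner)
  also have "\<dots> = coord_proj T v \<bullet> w" by (simp add: v_def inner_coord_proj)
  also have "\<dots> = (coord_proj S z v* M) \<bullet> coord_proj T v"
    unfolding w_def transpose_matrix_vector by (rule inner_commute)
  also have "\<dots> = coord_proj S z \<bullet> (M *v coord_proj T v)" by (rule dot_lmul_matrix)
  also have "\<dots> = z \<bullet> coord_proj S (M *v coord_proj T v)" by (rule inner_coord_proj)
  also have "\<dots> \<le> norm z * (sub_norm M S T * norm v)"
    using norm_cauchy_schwarz norm_block_le_sub_norm by (rule order_trans[OF _ mult_left_mono]) simp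
  finally have "norm v * norm v \<le> norm v * (sub_norm M S T * norm z)"
    by (simp add: power2_eq_square mult_ac)
  then show "norm v \<le> sub_norm M S T * norm z"
    using sub_norm_nonneg[of M S T] by (cases "norm v = 0") auto
qed

lemma sub_norm_transpose: "sub_norm (transpose M) T S = sub_norm M S T"
proof (rule antisym)
  show "sub_norm M S T \<le> sub_norm (transpose M) T S"
    using sub_norm_transpose_le[of "transpose M" S T] by simp
qed (rule sub_norm_transpose_le)

definition coord_reflect :: "'n set \<Rightarrow> real^'n \<Rightarrow> real^'n" where
  "coord_reflect S x = (\<chi> i. if i \<in> S then x $ i else - x $ i)"

lemma coord_reflect_component [simp]: "coord_reflect S x $ i = (if i \<in> S then x $ i else - x $ i)"
  by (simp add: coord_reflect_def)

lemma coord_reflect_coord_reflect [simp]: "coord_reflect S (coord_reflect S x) = x"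
  by (simp add: vec_eq_iff)

lemma norm_coord_reflect [simp]: "norm (coord_reflect S x) = norm x"
proof -
  have "\<bar>coord_reflect S x $ i\<bar> = \<bar>x $ i\<bar>" for i by simp
  then show ?thesis unfolding norm_vec_def L2_set_def by simp
qed

lemma reflect_conj_diff_eq:
  "M *v x - coord_reflect S (M *v coord_reflect S x)
    = 2 *\<^sub>R (coord_proj S (M *v coord_proj (-S) x) + coord_proj (-S) (M *v coord_proj S x))"
proof -
  have "x - coord_reflect S x = 2 *\<^sub>R coord_proj (-S) x" "x + coord_reflect S x = 2 *\<^sub>R coord_proj S x"
    by (simp_all add: vec_eq_iff)
  then have "M *v x - M *v coord_reflect S x = 2 *\<^sub>R (M *v coord_proj (-S) x)"
    "M *v x + M *v coord_reflect S x = 2 *\<^sub>R (M *v coord_proj S x)"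
    by (simp_all add: matrix_vector_mult_scaleR flip: matrix_vector_mult_diff_distrib matrix_vector_right_distrib)
  then show ?thesis by (auto simp: vec_eq_iff)
qed

lemma norm_reflect_conj_diff_le:
  fixes M :: "real^'n^'n"
  assumes sym: "transpose M = M"
  shows "norm (M *v x - coord_reflect S (M *v coord_reflect S x)) \<le> 2 * sub_norm M S (-S) * norm x"
proof -
  let ?e = "sub_norm M S (-S)"
  let ?X = "coord_proj S (M *v coord_proj (-S) x)" and ?Y = "coord_proj (-S) (M *v coord_proj S x)"
  have "norm ?X \<le> ?e * norm (coord_proj (-S) x)"
    using norm_block_le_sub_norm[of S M "-S" "coord_proj (-S) x"] by simp
  moreover have "norm ?Y \<le> ?e * norm (coord_proj S x)"
    using norm_block_le_sub_norm[of "-S" M S "coord_proj S x"] sub_norm_transpose[of M "-S" S, unfolded sym]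
    by simp
  ultimately have "(norm ?X)\<^sup>2 + (norm ?Y)\<^sup>2 \<le> (?e * norm (coord_proj (-S) x))\<^sup>2 + (?e * norm (coord_proj S x))\<^sup>2"
    by (intro add_mono power_mono) simp_all
  also have "\<dots> = (?e * norm x)\<^sup>2"
    using norm_coord_proj_add_Compl_squared[of S x x] by (simp add: algebra_simps)
  finally have "(norm (?X + ?Y))\<^sup>2 \<le> (?e * norm x)\<^sup>2"
    by (simp only: norm_coord_proj_add_Compl_squared)
  then have "norm (?X + ?Y) \<le> ?e * norm x"
    by (rule power2_le_imp_le) (simp add: sub_norm_nonneg)
  then show ?thesis unfolding reflect_conj_diff_eq by simp
qed

lemma norm_block_funpow_le:
  fixes M :: "real^'n^'n"
  assumes sym: "transpose M = M" and r: "\<And>x. norm (M *v x) \<le> r * norm x" "0 \<le> r"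
  shows "norm (coord_proj S (((*v) M ^^ k) (coord_proj (-S) x)))
    \<le> real k * r ^ (k - 1) * sub_norm M S (-S) * norm x"
proof -
  let ?R = "coord_reflect S" and ?e = "sub_norm M S (-S)"
  define g where "g x = ?R (M *v ?R x)" for x
  have g_pow: "(g ^^ j) x = ?R (((*v) M ^^ j) (?R x))" for j x
    by (induction j) (simp_all add: g_def)
  have telescope: "norm (((*v) M ^^ k) y - (g ^^ k) y) \<le> real k * r ^ (k - 1) * (2 * ?e) * norm y" for y
  proof (rule norm_funpow_diff_le[OF matrix_vector_mul_linear r(1) _ r(2)])
    show "norm (g x) \<le> r * norm x" for x using r(1)[of "?R x"] by (simp add: g_def)
    show "norm (M *v x - g x) \<le> 2 * ?e * norm x" for x
      unfolding g_def by (rule norm_reflect_conj_diff_le[OF sym])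
    show "0 \<le> 2 * ?e" using sub_norm_nonneg by simp
  qed
  define y where "y = coord_proj (-S) x"
  define z where "z = ((*v) M ^^ k) y"
  have "?R y = - y" by (simp add: y_def vec_eq_iff)
  then have "(g ^^ k) y = ?R (- z)"
    using linear_neg[OF linear_funpow[OF matrix_vector_mul_linear[of M], of k], of y]
    by (simp add: g_pow z_def)
  then have "(g ^^ k) y = - ?R z" by (simp add: vec_eq_iff)
  then have "coord_proj S (((*v) M ^^ k) y - (g ^^ k) y) = 2 *\<^sub>R coord_proj S z"
    by (simp add: z_def vec_eq_iff)
  then have "2 * norm (coord_proj S z) = norm (coord_proj S (((*v) M ^^ k) y - (g ^^ k) y))" by simp
  also have "\<dots> \<le> norm (((*v) M ^^ k) y - (g ^^ k) y)" by (rule norm_coord_proj_le)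
  also have "\<dots> \<le> real k * r ^ (k - 1) * (2 * ?e) * norm y" by (rule telescope)
  also have "\<dots> \<le> real k * r ^ (k - 1) * (2 * ?e) * norm x"
    unfolding y_def using r(2) sub_norm_nonneg[of M S "-S"]
    by (intro mult_left_mono norm_coord_proj_le mult_nonneg_nonneg) simp_all
  finally show ?thesis by (simp add: z_def y_def)
qed

section \<open>The off-diagonal block of the covariance\<close>

lemma mat_fun_powr_series:
  fixes M :: "real^'n^'n"
  assumes sym: "transpose M = M" and \<rho>: "spec_radius M < 1"
  shows "(\<lambda>k. neg_binomial_coeff a k *\<^sub>R ((*v) M ^^ k) y) sums (mat_fun (\<lambda>x. x powr -a) (mat 1 - M) *v y)"
proof -
  obtain B ev where B: "orthonormal_basis B" and eig: "\<And>u. u \<in> B \<Longrightarrow> M *v u = ev u *\<^sub>R u"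
    using symmetric_matrix_orthonormal_eigenbasis[OF sym] by blast
  have "(\<lambda>k. (neg_binomial_coeff a k * ev u ^ k * (y \<bullet> u)) *\<^sub>R u)
    sums (((1 - ev u) powr -a * (y \<bullet> u)) *\<^sub>R u)" if "u \<in> B" for u
  proof -
    have "\<bar>ev u\<bar> < 1"
      using abs_le_spec_radius[OF sym eigenvector_in_eigvals[OF orthonormal_basis_nonzero[OF B that] eig[OF that]]] \<rho>
      by linarith
    from sums_scaleR_left[OF sums_mult2[OF neg_binomial_series[OF this]]] show ?thesis .
  qed
  then have "(\<lambda>k. \<Sum>u\<in>B. (neg_binomial_coeff a k * ev u ^ k * (y \<bullet> u)) *\<^sub>R u)
    sums (\<Sum>u\<in>B. ((1 - ev u) powr -a * (y \<bullet> u)) *\<^sub>R u)"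
    by (rule sums_sum)
  moreover have "neg_binomial_coeff a k *\<^sub>R ((*v) M ^^ k) y
    = (\<Sum>u\<in>B. (neg_binomial_coeff a k * ev u ^ k * (y \<bullet> u)) *\<^sub>R u)" for k
  proof -
    have "((*v) M ^^ k) y = (\<Sum>u\<in>B. (ev u ^ k * (y \<bullet> u)) *\<^sub>R u)"
      using linear_funpow[OF matrix_vector_mul_linear] B
      by (rule linear_eigenbasis_expand) (rule funpow_eigenvector[OF matrix_vector_mul_linear eig])
    then show ?thesis by (simp add: scaleR_sum_right mult.assoc)
  qed
  moreover have "mat_fun (\<lambda>x. x powr -a) (mat 1 - M) *v y = (\<Sum>u\<in>B. ((1 - ev u) powr -a * (y \<bullet> u)) *\<^sub>R u)"
    using B by (rule matrix_eigenbasis_expand) (rule mat_fun_one_minus_eigenvector[OF sym eig])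
  ultimately show ?thesis by simp
qed

lemma sub_norm_mat_fun_powr_le:
  fixes M :: "real^'n^'n"
  assumes sym: "transpose M = M" and \<rho>: "spec_radius M < 1" and "0 \<le> a"
  shows "sub_norm (mat_fun (\<lambda>x. x powr -a) (mat 1 - M)) S (-S)
    \<le> a * (1 - spec_radius M) powr (-a - 1) * sub_norm M S (-S)"
  unfolding sub_norm_eq_onorm[of "mat_fun _ _"]
proof (rule onorm_le)
  fix x
  let ?G = "mat_fun (\<lambda>x. x powr -a) (mat 1 - M)" and ?\<rho> = "spec_radius M" and ?e = "sub_norm M S (-S)"
  have "0 \<le> ?\<rho>" by (rule spec_radius_nonneg[OF sym])
  have "(\<lambda>k. coord_proj S (neg_binomial_coeff a k *\<^sub>R ((*v) M ^^ k) (coord_proj (-S) x)))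
    sums coord_proj S (?G *v coord_proj (-S) x)"
    using bounded_linear_coord_proj mat_fun_powr_series[OF sym \<rho>] by (rule bounded_linear.sums)
  moreover have "(\<lambda>k. neg_binomial_coeff a k * (real k * ?\<rho> ^ (k - 1)) * (?e * norm x))
    sums (a * (1 - ?\<rho>) powr (-a - 1) * (?e * norm x))"
    using \<rho> \<open>0 \<le> ?\<rho>\<close> by (intro sums_mult2 neg_binomial_series_deriv) simp
  moreover have "norm (coord_proj S (neg_binomial_coeff a k *\<^sub>R ((*v) M ^^ k) (coord_proj (-S) x)))
    \<le> neg_binomial_coeff a k * (real k * ?\<rho> ^ (k - 1)) * (?e * norm x)" for k
    using norm_block_funpow_le[OF sym norm_matrix_vector_le_spec_radius[OF sym] \<open>0 \<le> ?\<rho>\<close>, of S k x]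
      neg_binomial_coeff_nonneg[OF \<open>0 \<le> a\<close>, of k]
    by (simp add: linear_scale[OF linear_coord_proj] mult_left_mono mult.assoc)
  ultimately have "norm (coord_proj S (?G *v coord_proj (-S) x)) \<le> a * (1 - ?\<rho>) powr (-a - 1) * (?e * norm x)"
    by (rule norm_sums_le)
  then show "norm (coord_proj S (?G *v coord_proj (-S) x)) \<le> a * (1 - ?\<rho>) powr (-a - 1) * ?e * norm x"
    by (simp add: mult.assoc)
qed

theorem lemma2:
  fixes A Abar :: "real^'n^'n" and \<sigma> \<alpha> :: real and S S' :: "'n set"
  assumes "transpose A = A" and "\<forall>i j. 0 \<le> A $ i $ j"
    and "transpose Abar = Abar" and "\<forall>i j. i \<noteq> j \<longrightarrow> Abar $ i $ j = A $ i $ j"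
    and "spec_radius Abar < 1"
    and "\<sigma> > 0" and "\<alpha> > 1"
    and "S \<union> S' = UNIV" and "S \<inter> S' = {}" and "S \<noteq> {}" and "S' \<noteq> {}"
  shows "lambda_min (\<sigma>\<^sup>2 *\<^sub>R mat_fun (\<lambda>x. x powr (-\<alpha>)) (mat 1 - Abar))
           = \<sigma>\<^sup>2 * (1 - lambda_min Abar) powr (-\<alpha>)
       \<and> sub_norm (\<sigma>\<^sup>2 *\<^sub>R mat_fun (\<lambda>x. x powr (-\<alpha>)) (mat 1 - Abar)) S S'
           \<le> \<sigma>\<^sup>2 * \<alpha> * (1 - spec_radius Abar) powr (-\<alpha> - 1) * sub_norm A S S'"
proof -
  have S': "S' = - S" using assms(8,9) by blast
  have "sub_norm Abar S S' = sub_norm A S S'"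
  proof (rule sub_norm_cong)
    fix i j assume "i \<in> S" "j \<in> S'"
    then have "i \<noteq> j" using assms(9) by blast
    then show "Abar $ i $ j = A $ i $ j" using assms(4) by simp
  qed
  then show ?thesis
    using lambda_min_scaleR_mat_fun_powr[OF assms(3,5), of "\<sigma>\<^sup>2" \<alpha>]
      sub_norm_mat_fun_powr_le[OF assms(3,5), of \<alpha> S] assms(6,7)
    by (simp add: S' sub_norm_scaleR mult.assoc mult_left_mono)
qed

end
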